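(* Let $G=(V,E)$ be an $n$-vertex hypergraph of rank $r$, and let $c_1,\dots,c_t\colon E\to\mathbb{Z}_+$ be $t$ non-negative hyperedge-cost functions. Then the number of distinct multiobjective min-cuts of $(G,c_1,\dots,c_t)$ is $O(r\,2^{rt}\,n^{3t-1})$.
   Context: The rank of a hypergraph is the size of its largest hyperedge. For $U\subseteq V$, $\delta(U)$ denotes the set of hyperedges intersecting both $U$ and $V\setminus U$. A set $F\subseteq E$ is a cut if $F=\delta(U)$ for some $\emptyset\neq U\subsetneq V$. For $F\subseteq E$, $c_i(F)=\sum_{e\in F}c_i(e)$. For a budget-vector $b\in\mathbb{R}^{t-1}_+$, a cut $F$ is a $b$-multiobjective min-cut if $c_i(F)\le b_i$ for every $i\in[t-1]$ and $c_t(F)$ is minimum among all cuts satisfying these constraints. A cut is a multiobjective min-cut if it is a $b$-multiobjective min-cut for some $b\in\mathbb{R}^{t-1}_+$. Cuts are counted as distinct sets of hyperedges.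
   Formalization: Added: every nonempty cut has positive c_t-cost (automatic for positive c_t), E is nonempty and r ≥ 1. With merely non-negative costs the claim fails: for t=1, c_1=0 on the complete graph K_n, all 2^(n-1)-1 cuts are multiobjective min-cuts. *)

theory Defs
  imports Complex_Main
begin

text \<open>
  A hypergraph is given by a vertex set \<open>V\<close>, a set \<open>E\<close> of (names of) hyperedges and a map
  \<open>ends\<close> sending each hyperedge to the set of vertices it contains. Parallel hyperedges are thus
  allowed; if \<open>E\<close> is a set of subsets of \<open>V\<close>, take \<open>ends\<close> to be the identity.
\<close>

definition hypergraph :: "'v set \<Rightarrow> 'e set \<Rightarrow> ('e \<Rightarrow> 'v set) \<Rightarrow> bool" where
  "hypergraph V E ends \<longleftrightarrow> finite V \<and> finite E \<and> (\<forall>e\<in>E. ends e \<subseteq> V)"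

text \<open>Only meaningful for \<open>E \<noteq> {}\<close>.\<close>

definition rank :: "'e set \<Rightarrow> ('e \<Rightarrow> 'v set) \<Rightarrow> nat" where
  "rank E ends = Max ((\<lambda>e. card (ends e)) ` E)"

definition delta :: "'v set \<Rightarrow> 'e set \<Rightarrow> ('e \<Rightarrow> 'v set) \<Rightarrow> 'v set \<Rightarrow> 'e set" where
  "delta V E ends U = {e \<in> E. ends e \<inter> U \<noteq> {} \<and> ends e \<inter> (V - U) \<noteq> {}}"

definition is_cut :: "'v set \<Rightarrow> 'e set \<Rightarrow> ('e \<Rightarrow> 'v set) \<Rightarrow> 'e set \<Rightarrow> bool" where
  "is_cut V E ends F \<longleftrightarrow> (\<exists>U. U \<noteq> {} \<and> U \<subset> V \<and> F = delta V E ends U)"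

text \<open>
  The cost functions are \<open>c 1, \<dots>, c t\<close> and the budgets \<open>b 1, \<dots>, b (t - 1)\<close>; the values of \<open>c\<close>
  and \<open>b\<close> at other indices are irrelevant.
\<close>

definition within_budget :: "nat \<Rightarrow> (nat \<Rightarrow> 'e \<Rightarrow> nat) \<Rightarrow> (nat \<Rightarrow> real) \<Rightarrow> 'e set \<Rightarrow> bool" where
  "within_budget t c b F \<longleftrightarrow> (\<forall>i\<in>{1..<t}. real (\<Sum>e\<in>F. c i e) \<le> b i)"

definition is_budget_min_cut ::
  "'v set \<Rightarrow> 'e set \<Rightarrow> ('e \<Rightarrow> 'v set) \<Rightarrow> nat \<Rightarrow> (nat \<Rightarrow> 'e \<Rightarrow> nat) \<Rightarrow> (nat \<Rightarrow> real) \<Rightarrow> 'e set \<Rightarrow> bool"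
where
  "is_budget_min_cut V E ends t c b F \<longleftrightarrow>
     is_cut V E ends F \<and> within_budget t c b F \<and>
     (\<forall>F'. is_cut V E ends F' \<and> within_budget t c b F' \<longrightarrow> (\<Sum>e\<in>F. c t e) \<le> (\<Sum>e\<in>F'. c t e))"

definition is_multiobjective_min_cut ::
  "'v set \<Rightarrow> 'e set \<Rightarrow> ('e \<Rightarrow> 'v set) \<Rightarrow> nat \<Rightarrow> (nat \<Rightarrow> 'e \<Rightarrow> nat) \<Rightarrow> 'e set \<Rightarrow> bool"
where
  "is_multiobjective_min_cut V E ends t c F \<longleftrightarrow>
     (\<exists>b. (\<forall>i\<in>{1..<t}. 0 \<le> b i) \<and> is_budget_min_cut V E ends t c b F)"

text \<open>
  Some condition of this kind is indispensable for the bound on the number of multiobjective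
  min-cuts: if \<open>t = 1\<close> and the only cost function vanishes identically, then every cut is a
  multiobjective min-cut, and a complete graph on \<open>n\<close> vertices has \<open>2 ^ (n - 1) - 1\<close> cuts.
  The condition holds in particular whenever \<open>c t\<close> is positive on all hyperedges.
\<close>

definition no_free_cut ::
  "'v set \<Rightarrow> 'e set \<Rightarrow> ('e \<Rightarrow> 'v set) \<Rightarrow> ('e \<Rightarrow> nat) \<Rightarrow> bool"
where
  "no_free_cut V E ends w \<longleftrightarrow> (\<forall>F. is_cut V E ends F \<and> F \<noteq> {} \<longrightarrow> 0 < (\<Sum>e\<in>F. w e))"

end

theory Submission
  imports Defs "HOL-Combinatorics.Multiset_Permutations"
begin

text \<open>
  A variant of Karger's contraction algorithm with one random contraction order per criterion. If
  \<open>F\<close> is a multiobjective min-cut, then every cut \<open>F'\<close> of a contraction that spares \<open>F\<close> satisfies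
  \<open>c i F \<le> c i F'\<close> for some \<open>i\<close>. Applied to the boundaries of the \<open>k\<close> remaining vertices, this yields
  a criterion for which a random hyperedge hits \<open>F\<close> with probability at most \<open>t / k\<close> times the mean
  hyperedge size. Always contracting along such a criterion down to \<open>r * t\<close> vertices, \<open>F\<close> survives
  with probability at least \<open>1 / (r * n ^ (2 * t))\<close>. The choice of criteria depends on \<open>F\<close>, but since
  the resulting partition depends only on how far each order has been followed, it takes at most
  \<open>n ^ (t - 1)\<close> values for given orders, each of which leaves at most \<open>2 ^ (r * t)\<close> cuts.
\<close>

section \<open>Connectivity by contracted hyperedges\<close>

text \<open>The classes are the vertices that remain after contracting \<open>S\<close>. The closure
  is reflexive on the whole type, so a vertex in no contracted hyperedge forms a class of its
  own.\<close>

definition link :: "('e \<Rightarrow> 'v set) \<Rightarrow> 'e set \<Rightarrow> ('v \<times> 'v) set" where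
  "link ends S = (\<Union>e\<in>S. ends e \<times> ends e)\<^sup>*"

definition comps :: "'v set \<Rightarrow> ('e \<Rightarrow> 'v set) \<Rightarrow> 'e set \<Rightarrow> 'v set set" where
  "comps V ends S = (\<lambda>v. link ends S `` {v}) ` V"

abbreviation num_comps :: "'v set \<Rightarrow> ('e \<Rightarrow> 'v set) \<Rightarrow> 'e set \<Rightarrow> nat" where
  "num_comps V ends S \<equiv> card (comps V ends S)"

text \<open>The hyperedges that have not become loops in the contraction of
  \<open>S\<close>.\<close>

definition crossing :: "'e set \<Rightarrow> ('e \<Rightarrow> 'v set) \<Rightarrow> 'e set \<Rightarrow> 'e set" where
  "crossing E ends S = {e \<in> E. \<not> ends e \<times> ends e \<subseteq> link ends S}"

text \<open>The hyperedge \<open>e\<close> as seen in the contraction; its cardinality replaces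
  \<open>card (ends e)\<close> there.\<close>

definition hits :: "'v set \<Rightarrow> ('e \<Rightarrow> 'v set) \<Rightarrow> 'e set \<Rightarrow> 'e \<Rightarrow> 'v set set" where
  "hits V ends S e = {K \<in> comps V ends S. K \<inter> ends e \<noteq> {}}"

lemma link_refl [simp]: "(v, v) \<in> link ends S"
  by (simp add: link_def)

lemma link_sym: "(v, w) \<in> link ends S \<Longrightarrow> (w, v) \<in> link ends S"
  unfolding link_def by (rule symD[OF sym_rtrancl]) (auto simp: sym_def)

lemma link_trans: "(u, v) \<in> link ends S \<Longrightarrow> (v, w) \<in> link ends S \<Longrightarrow> (u, w) \<in> link ends S"
  unfolding link_def by (rule rtrancl_trans)

lemma link_mono: "S \<subseteq> S' \<Longrightarrow> link ends S \<subseteq> link ends S'"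
  unfolding link_def by (rule rtrancl_mono) auto

lemma link_edge: "e \<in> S \<Longrightarrow> x \<in> ends e \<Longrightarrow> y \<in> ends e \<Longrightarrow> (x, y) \<in> link ends S"
  unfolding link_def by (rule r_into_rtrancl) auto

lemma link_class_eq: "(v, w) \<in> link ends S \<Longrightarrow> link ends S `` {v} = link ends S `` {w}"
  by (auto dest: link_sym intro: link_trans)

lemma link_insert_loop:
  assumes "ends e \<times> ends e \<subseteq> link ends S"
  shows "link ends (insert e S) = link ends S"
proof
  have "(\<Union>e\<in>insert e S. ends e \<times> ends e) \<subseteq> link ends S"
    using assms by (auto intro: link_edge)
  then show "link ends (insert e S) \<subseteq> link ends S"
    unfolding link_def by (metis rtrancl_idemp rtrancl_mono)
qed (rule link_mono, blast)

lemma link_closed: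
  assumes "(v, w) \<in> link ends S" "v \<in> U"
    and "\<And>e. e \<in> S \<Longrightarrow> ends e \<inter> U \<noteq> {} \<Longrightarrow> ends e \<subseteq> U"
  shows "w \<in> U"
  using assms(1) unfolding link_def
  by (induction rule: rtrancl_induct) (use assms(2,3) in auto)

lemma finite_comps [simp]: "finite V \<Longrightarrow> finite (comps V ends S)"
  by (simp add: comps_def)

text \<open>Further contraction only merges components, so it maps the old ones onto the new ones.
  Both bounds on the drop of \<open>num_comps\<close> come from this surjection.\<close>

lemma comps_image_mono:
  assumes "S \<subseteq> S'"
  shows "comps V ends S' = (\<lambda>K. link ends S' `` K) ` comps V ends S"
proof -
  have "link ends S' `` (link ends S `` {v}) = link ends S' `` {v}" for v
    using link_mono[OF assms, of ends] by (auto intro: link_trans)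
  then show ?thesis
    by (simp add: comps_def image_image)
qed

lemma num_comps_antimono:
  "finite V \<Longrightarrow> S \<subseteq> S' \<Longrightarrow> num_comps V ends S' \<le> num_comps V ends S"
  by (simp add: comps_image_mono card_image_le)

lemma num_comps_le: "finite V \<Longrightarrow> num_comps V ends S \<le> card V"
  by (simp add: comps_def card_image_le)

lemma num_comps_empty [simp]: "num_comps V ends {} = card V"
  by (simp add: comps_def link_def card_image)

lemma crossing_antimono: "S \<subseteq> S' \<Longrightarrow> crossing E ends S' \<subseteq> crossing E ends S"
  using link_mono[of S S' ends] by (auto simp: crossing_def)

lemma crossing_disjoint: "crossing E ends S \<inter> S = {}"
  by (auto simp: crossing_def intro: link_edge)

text \<open>All components that \<open>e\<close> hits have one common image under the merging map,
  and the others contribute at most one image each.\<close>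

lemma num_comps_insert:
  assumes "finite V"
  shows "num_comps V ends (insert e S) + card (hits V ends S e) \<le> num_comps V ends S + 1"
proof -
  let ?H = "hits V ends S e" and ?C = "comps V ends S" and ?R = "link ends (insert e S)"
  have fin: "finite ?C" and sub: "?H \<subseteq> ?C"
    using assms by (auto simp: hits_def)
  have hit_image: "?R `` K \<subseteq> ?R `` L" if K: "K \<in> ?H" and L: "L \<in> ?H" for K L
  proof
    fix w assume "w \<in> ?R `` K"
    then obtain k where k: "k \<in> K" "(k, w) \<in> ?R" by auto
    obtain x where x: "x \<in> K" "x \<in> ends e" using K unfolding hits_def by blast
    obtain y where y: "y \<in> L" "y \<in> ends e" using L unfolding hits_def by blast
    have "(x, k) \<in> link ends S"
      using K x k by (auto simp: hits_def comps_def dest: link_sym intro: link_trans)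
    then have "(x, k) \<in> ?R" using link_mono[of S "insert e S" ends] by auto
    moreover have "(y, x) \<in> ?R" using x y by (intro link_edge[of e]) auto
    ultimately show "w \<in> ?R `` L" using k y by (blast intro: link_trans)
  qed
  have "?R `` K = ?R `` L" if "K \<in> ?H" "L \<in> ?H" for K L
    using hit_image[OF that] hit_image[OF that(2,1)] by (rule subset_antisym)
  then have "\<forall>X\<in>(\<lambda>K. ?R `` K) ` ?H. \<forall>Y\<in>(\<lambda>K. ?R `` K) ` ?H. X = Y"
    by (intro ballI) (elim imageE, hypsubst)
  moreover have "finite ((\<lambda>K. ?R `` K) ` ?H)" using fin sub finite_subset by blast
  ultimately have "card ((\<lambda>K. ?R `` K) ` ?H) \<le> 1"
    unfolding One_nat_def by (rule card_le_Suc0_iff_eq[THEN iffD2, rotated])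
  moreover have "comps V ends (insert e S) = (\<lambda>K. ?R `` K) ` ?H \<union> (\<lambda>K. ?R `` K) ` (?C - ?H)"
    using sub by (subst comps_image_mono[of S]) auto
  moreover have "card ((\<lambda>K. ?R `` K) ` (?C - ?H)) \<le> card ?C - card ?H"
    using fin sub by (metis card_Diff_subset card_image_le finite_Diff finite_subset)
  moreover have "card ?H \<le> card ?C" using fin sub by (rule card_mono)
  ultimately show ?thesis
    using card_Un_le[of "(\<lambda>K. ?R `` K) ` ?H" "(\<lambda>K. ?R `` K) ` (?C - ?H)"] by simp
qed

lemma hits_ge_2:
  assumes "finite V" "ends e \<subseteq> V" "e \<in> crossing E ends S"
  shows "2 \<le> card (hits V ends S e)"
proof -
  obtain x y where xy: "x \<in> ends e" "y \<in> ends e" "(x, y) \<notin> link ends S"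
    using assms(3) by (auto simp: crossing_def)
  let ?X = "link ends S `` {x}" and ?Y = "link ends S `` {y}"
  have "?X \<noteq> ?Y" using xy(3) by (metis Image_singleton_iff link_refl)
  moreover have "link ends S `` {z} \<in> hits V ends S e" if "z \<in> ends e" for z
    using that assms(2) link_refl[of z ends S] unfolding hits_def comps_def by blast
  then have "{?X, ?Y} \<subseteq> hits V ends S e" using xy by simp
  moreover have "finite (hits V ends S e)" using assms(1) by (simp add: hits_def)
  ultimately show ?thesis by (metis card_2_iff card_mono)
qed

lemma hits_le:
  assumes "finite (ends e)"
  shows "card (hits V ends S e) \<le> card (ends e)"
proof -
  have "hits V ends S e \<subseteq> (\<lambda>v. link ends S `` {v}) ` ends e"
  proof
    fix K assume "K \<in> hits V ends S e"
    then obtain v x where K: "K = link ends S `` {v}" and x: "x \<in> ends e" "(v, x) \<in> link ends S"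
      by (auto simp: hits_def comps_def)
    have "K = link ends S `` {x}" unfolding K using x(2) by (rule link_class_eq)
    then show "K \<in> (\<lambda>v. link ends S `` {v}) ` ends e" using x(1) by (rule image_eqI)
  qed
  with assms show ?thesis by (rule surj_card_le)
qed

lemma num_comps_insert_crossing:
  assumes "finite V" "ends e \<subseteq> V" "e \<in> crossing E ends S"
  shows "num_comps V ends (insert e S) < num_comps V ends S"
  using num_comps_insert[OF assms(1), of ends e S] hits_ge_2[OF assms] by linarith

text \<open>If \<open>e\<close> were a loop for \<open>S'\<close> only, adding it would lower the
  count for \<open>S\<close> and keep it for \<open>S'\<close>, contradicting monotonicity. Hence
  along a chain of contractions the number of components alone determines the loops.\<close>

lemma crossing_eq_if_num_comps_eq:
  assumes "finite V" "\<And>e. e \<in> E \<Longrightarrow> ends e \<subseteq> V" "S \<subseteq> S'"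
    and "num_comps V ends S = num_comps V ends S'"
  shows "crossing E ends S = crossing E ends S'"
proof (rule antisym[OF subsetI crossing_antimono[OF assms(3)]])
  fix e assume e: "e \<in> crossing E ends S"
  show "e \<in> crossing E ends S'"
  proof (rule ccontr)
    assume "e \<notin> crossing E ends S'"
    then have "comps V ends (insert e S') = comps V ends S'"
      using e by (auto simp: crossing_def comps_def link_insert_loop)
    moreover have "num_comps V ends (insert e S') \<le> num_comps V ends (insert e S)"
      using assms by (intro num_comps_antimono) auto
    moreover have "num_comps V ends (insert e S) < num_comps V ends S"
      using e assms by (intro num_comps_insert_crossing) (auto simp: crossing_def)
    ultimately show False using assms(4) by simp
  qed
qed

section \<open>Cuts that survive a contraction\<close>

lemma cut_subset: "is_cut V E ends F \<Longrightarrow> F \<subseteq> E"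
  by (auto simp: is_cut_def delta_def)

text \<open>A hyperedge of \<open>S\<close> that meets \<open>U\<close> cannot leave it without
  lying in the cut. So the sides of a cut avoiding \<open>S\<close> are unions of
  components.\<close>

lemma avoiding_cut_closed:
  assumes "hypergraph V E ends" "S \<subseteq> E" "delta V E ends U \<inter> S = {}"
    and "(v, w) \<in> link ends S" "v \<in> U"
  shows "w \<in> U"
proof (rule link_closed[OF assms(4,5)])
  fix e assume "e \<in> S" "ends e \<inter> U \<noteq> {}"
  moreover from this assms have "e \<in> E" "e \<notin> delta V E ends U" "ends e \<subseteq> V"
    by (auto simp: hypergraph_def)
  ultimately show "ends e \<subseteq> U" by (auto simp: delta_def)
qed

lemma avoiding_cut_crossing:
  assumes "hypergraph V E ends" "S \<subseteq> E" "is_cut V E ends F" "F \<inter> S = {}"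
  shows "F \<subseteq> crossing E ends S"
proof
  fix e assume e: "e \<in> F"
  obtain U where U: "F = delta V E ends U" using assms(3) by (auto simp: is_cut_def)
  obtain x y where "x \<in> ends e" "x \<in> U" "y \<in> ends e" "y \<notin> U"
    using e U by (auto simp: delta_def)
  moreover have "e \<in> E" using e cut_subset[OF assms(3)] by auto
  ultimately show "e \<in> crossing E ends S"
    using avoiding_cut_closed[OF assms(1,2), of U x y] assms(4) U by (auto simp: crossing_def)
qed

text \<open>Such a cut is determined by the set of components that make up one of its sides.\<close>

lemma card_avoiding_cuts:
  assumes "hypergraph V E ends" "S \<subseteq> E"
  shows "card {F. is_cut V E ends F \<and> F \<inter> S = {}} \<le> 2 ^ num_comps V ends S"
proof -
  have fin: "finite (comps V ends S)" using assms by (simp add: hypergraph_def)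
  have "{F. is_cut V E ends F \<and> F \<inter> S = {}} \<subseteq> (\<lambda>A. delta V E ends (\<Union>A)) ` Pow (comps V ends S)"
  proof
    fix F assume "F \<in> {F. is_cut V E ends F \<and> F \<inter> S = {}}"
    then obtain U where U: "U \<subseteq> V" "F = delta V E ends U" "F \<inter> S = {}"
      by (auto simp: is_cut_def)
    have "\<Union>((\<lambda>v. link ends S `` {v}) ` U) = U"
      using avoiding_cut_closed[OF assms, of U] U by auto
    moreover have "(\<lambda>v. link ends S `` {v}) ` U \<in> Pow (comps V ends S)"
      using U by (auto simp: comps_def)
    ultimately show "F \<in> (\<lambda>A. delta V E ends (\<Union>A)) ` Pow (comps V ends S)"
      using U(2) by (metis (no_types, lifting) image_eqI)
  qed
  then have "card {F. is_cut V E ends F \<and> F \<inter> S = {}} \<le> card (Pow (comps V ends S))"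
    using fin by (intro surj_card_le) auto
  then show ?thesis using fin by (simp add: card_Pow)
qed

text \<open>The boundaries of single components are the test cuts with which \<open>F\<close> will
  be compared.\<close>

lemma comp_is_cut:
  assumes "hypergraph V E ends" "S \<subseteq> E" "K \<in> comps V ends S" "2 \<le> num_comps V ends S"
  shows "is_cut V E ends (delta V E ends K)"
proof -
  obtain v where v: "v \<in> V" "K = link ends S `` {v}" using assms(3) by (auto simp: comps_def)
  have "K \<subseteq> V"
  proof
    fix w assume "w \<in> K"
    then show "w \<in> V"
      using assms(1,2) v by (intro link_closed[of v w ends S]) (auto simp: hypergraph_def)
  qed
  moreover have "K \<noteq> V"
  proof
    assume "K = V"
    then have "comps V ends S \<subseteq> {K}"
      using v link_class_eq[of v _ ends S] by (auto simp: comps_def)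
    then show False using assms(4) card_mono[of "{K}" "comps V ends S"] by simp
  qed
  moreover have "K \<noteq> {}" using v link_refl[of v ends S] by blast
  ultimately show ?thesis by (auto simp: is_cut_def)
qed

lemma delta_comp_subset:
  assumes "K \<in> comps V ends S"
  shows "delta V E ends K \<subseteq> {e \<in> crossing E ends S. K \<in> hits V ends S e}"
proof
  fix e assume e: "e \<in> delta V E ends K"
  obtain v where v: "K = link ends S `` {v}" using assms by (auto simp: comps_def)
  obtain x y where xy: "x \<in> ends e" "x \<in> K" "y \<in> ends e" "y \<notin> K"
    using e by (auto simp: delta_def)
  then have "(x, y) \<notin> link ends S" using v by (auto intro: link_trans)
  then show "e \<in> {e \<in> crossing E ends S. K \<in> hits V ends S e}"
    using e xy assms by (auto simp: crossing_def delta_def hits_def)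
qed

text \<open>Double counting: \<open>e\<close> lies in the boundary of no component other than those
  it hits.\<close>

lemma sum_delta_comps_le:
  fixes w :: "'e \<Rightarrow> nat"
  assumes "finite V" "finite E" "A \<subseteq> comps V ends S"
  shows "(\<Sum>K\<in>A. \<Sum>e\<in>delta V E ends K. w e)
    \<le> (\<Sum>e\<in>crossing E ends S. w e * card (hits V ends S e))"
proof -
  let ?N = "crossing E ends S"
  have finN: "finite ?N" using assms(2) by (simp add: crossing_def)
  have finC: "finite (comps V ends S)" using assms(1) by simp
  have "(\<Sum>K\<in>A. \<Sum>e\<in>delta V E ends K. w e)
      \<le> (\<Sum>K\<in>A. \<Sum>e\<in>{e \<in> ?N. K \<in> hits V ends S e}. w e)"
    using assms(3) finN by (intro sum_mono sum_mono2 delta_comp_subset) auto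
  also have "\<dots> \<le> (\<Sum>K\<in>comps V ends S. \<Sum>e\<in>{e \<in> ?N. K \<in> hits V ends S e}. w e)"
    using assms(3) finC by (intro sum_mono2) auto
  also have "\<dots> = (\<Sum>e\<in>?N. \<Sum>K\<in>{K \<in> comps V ends S. K \<in> hits V ends S e}. w e)"
    using finN finC by (rule sum.swap_restrict[symmetric])
  also have "\<dots> = (\<Sum>e\<in>?N. w e * card (hits V ends S e))"
    by (auto intro!: sum.cong simp: hits_def)
  finally show ?thesis .
qed

section \<open>The survival bound\<close>

text \<open>
  The reciprocal of the survival probability from \<open>k\<close> vertices on. The factor \<open>r\<close> pays for a last
  large hyperedge whose contraction overshoots \<open>r * t\<close>.
\<close>

definition loss :: "nat \<Rightarrow> nat \<Rightarrow> nat \<Rightarrow> nat" where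
  "loss r t k = (if k \<le> r * t then 1 else r * ((k - r * t + 2 * t) choose (2 * t)))"

lemma loss_pos: "1 \<le> r \<Longrightarrow> 0 < loss r t k"
  by (auto simp: loss_def)

lemma loss_mono:
  assumes "1 \<le> r" "k \<le> k'"
  shows "loss r t k \<le> loss r t k'"
proof -
  have "(k - r * t + 2 * t) choose (2 * t) \<le> (k' - r * t + 2 * t) choose (2 * t)"
    using assms by (intro binomial_right_mono) simp
  then show ?thesis using assms loss_pos[of r t k'] by (auto simp: loss_def)
qed

text \<open>Raising \<open>m + j - 1\<close> to \<open>m + j\<close> multiplies the binomial by
  \<open>1 + a / (m + j)\<close>, which is at least \<open>1 + a / (m + d)\<close> for
  \<open>j\<close> up to \<open>d\<close>. The product of these \<open>d\<close> factors is at least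
  \<open>1 + a * d / (m + d)\<close>.\<close>

lemma binomial_growth:
  "((m + a) choose a) * (m + d + a * d) \<le> (m + d) * ((m + d + a) choose a)"
proof (induction d)
  case (Suc d)
  let ?B = "(m + a) choose a" and ?n = "m + d"
  have rec: "Suc ?n * ((Suc ?n + a) choose a) = (Suc ?n + a) * ((?n + a) choose a)"
    using Suc_times_binomial_eq[of "?n + a" ?n]
    by (simp add: binomial_symmetric[of a "Suc (?n + a)"] binomial_symmetric[of a "?n + a"])
  show ?case
  proof (cases "?n = 0")
    case True
    then show ?thesis using rec by simp
  next
    case False
    \<comment> \<open>The right side exceeds the left by
      \<open>?B * a * (a + 1) * d\<close>.\<close>
    have "?n * (?B * (Suc ?n + a * Suc d)) \<le> (Suc ?n + a) * (?B * (?n + a * d))"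
      by (simp add: algebra_simps)
    also have "\<dots> \<le> (Suc ?n + a) * (?n * ((?n + a) choose a))"
      using Suc.IH by (rule mult_le_mono2)
    also have "\<dots> = ?n * (Suc ?n * ((Suc ?n + a) choose a))"
      using rec by (simp only: ac_simps)
    finally have "?B * (Suc ?n + a * Suc d) \<le> Suc ?n * ((Suc ?n + a) choose a)"
      using False by (simp only: nat_mult_le_cancel_disj)
    then show ?thesis by (simp only: add_Suc_right)
  qed
qed simp

text \<open>Drawing a hyperedge that hits \<open>s\<close> of \<open>n\<close> components leaves
  some \<open>k\<close> with \<open>k + s <= n + 1\<close>. The loss must then shrink by the factor
  \<open>1 + s * t / (n - r * t)\<close>, which pays for the risk of drawing from
  \<open>F\<close>.\<close>

lemma loss_step:
  assumes "r * t < n" "2 \<le> s" "s \<le> r" "k + s \<le> n + 1"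
  shows "loss r t k * (n - r * t + s * t) \<le> (n - r * t) * loss r t n"
proof -
  define m where "m = n - r * t"
  have m: "1 \<le> m" using assms(1) by (simp add: m_def)
  have ln: "loss r t n = r * ((m + 2 * t) choose (2 * t))"
    using assms(1) by (simp add: loss_def m_def)
  show ?thesis
  proof (cases "k \<le> r * t")
    case True
    \<comment> \<open>Here \<open>loss r t k\<close> is 1. The factor \<open>r\<close> of
      \<open>loss r t n\<close> absorbs \<open>s\<close>, and the binomial absorbs
      \<open>1 + 2 * t\<close>.\<close>
    have "1 + 2 * t = (1 + 2 * t) choose (2 * t)"
      by simp
    also have "\<dots> \<le> (m + 2 * t) choose (2 * t)"
      using m by (intro binomial_right_mono) simp
    finally have B: "1 + 2 * t \<le> (m + 2 * t) choose (2 * t)" .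
    have "s \<le> m * r" using mult_le_mono[OF m assms(3)] by simp
    moreover have "m * 1 \<le> m * r" using assms(2,3) by (intro mult_le_mono2) simp
    ultimately have "m + s * t \<le> m * r + m * r * (2 * t)"
      by (intro add_mono mult_le_mono) simp_all
    also have "\<dots> \<le> m * (r * ((m + 2 * t) choose (2 * t)))"
      using mult_le_mono2[OF B, of "m * r"] by (simp add: algebra_simps)
    finally show ?thesis using True ln by (simp add: loss_def m_def)
  next
    case False
    define m' where "m' = k - r * t"
    define d where "d = m - m'"
    \<comment> \<open>The drop \<open>d\<close> is at least \<open>s - 1\<close>, hence at least
      \<open>s / 2\<close> because \<open>s >= 2\<close>. This halving is why the binomial has lower
      index \<open>2 * t\<close> and not \<open>t\<close>.\<close>
    have d: "m = m' + d" "s \<le> 2 * d"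
      using assms False by (auto simp: m_def m'_def d_def)
    have "((m' + 2 * t) choose (2 * t)) * (m + s * t)
        \<le> ((m' + 2 * t) choose (2 * t)) * (m' + d + 2 * t * d)"
      using d mult_le_mono1[OF d(2), of t] by (simp add: algebra_simps)
    also have "\<dots> \<le> m * ((m + 2 * t) choose (2 * t))"
      using binomial_growth[of m' "2 * t" d] d(1) by simp
    finally have "r * (((m' + 2 * t) choose (2 * t)) * (m + s * t))
        \<le> r * (m * ((m + 2 * t) choose (2 * t)))"
      by (rule mult_le_mono2)
    then show ?thesis
      using False ln by (simp add: loss_def m_def m'_def algebra_simps)
  qed
qed


text \<open>What the contraction argument retains of multiobjective minimality, with the budgets
  eliminated. Positivity ensures that the criterion selected later still has crossing hyperedges to
  draw.\<close>

definition undominated ::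
  "'v set \<Rightarrow> 'e set \<Rightarrow> ('e \<Rightarrow> 'v set) \<Rightarrow> nat \<Rightarrow> (nat \<Rightarrow> 'e \<Rightarrow> nat) \<Rightarrow> 'e set \<Rightarrow> bool"
where
  "undominated V E ends t c F \<longleftrightarrow> is_cut V E ends F \<and>
     (\<forall>F'. is_cut V E ends F' \<longrightarrow>
        (\<exists>i\<in>{1..t}. (\<Sum>e\<in>F. c i e) \<le> (\<Sum>e\<in>F'. c i e) \<and> 0 < (\<Sum>e\<in>F'. c i e)))"

text \<open>If \<open>F'\<close> fits the budgets of \<open>F\<close>, criterion \<open>t\<close>
  works, with positive cost since \<open>F'\<close> is nonempty. Otherwise \<open>F'\<close>
  violates a budget that \<open>F\<close> respects, so that criterion is strictly larger on
  \<open>F'\<close>.\<close>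

lemma multiobjective_min_cut_undominated:
  assumes "is_multiobjective_min_cut V E ends t c F" "1 \<le> t"
    and "no_free_cut V E ends (c t)" "\<not> is_cut V E ends {}"
  shows "undominated V E ends t c F"
proof -
  obtain b where b: "\<forall>i\<in>{1..<t}. 0 \<le> b i" and F: "is_budget_min_cut V E ends t c b F"
    using assms(1) by (auto simp: is_multiobjective_min_cut_def)
  have "\<exists>i\<in>{1..t}. (\<Sum>e\<in>F. c i e) \<le> (\<Sum>e\<in>F'. c i e) \<and> 0 < (\<Sum>e\<in>F'. c i e)"
    if F': "is_cut V E ends F'" for F'
  proof (cases "within_budget t c b F'")
    case True
    then have "(\<Sum>e\<in>F. c t e) \<le> (\<Sum>e\<in>F'. c t e)"
      using F F' by (auto simp: is_budget_min_cut_def)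
    moreover have "0 < (\<Sum>e\<in>F'. c t e)"
      using F' assms(3,4) unfolding no_free_cut_def by metis
    ultimately show ?thesis using assms(2) by (intro bexI[of _ t]) auto
  next
    case False
    then obtain i where i: "i \<in> {1..<t}" "b i < real (\<Sum>e\<in>F'. c i e)"
      by (auto simp: within_budget_def not_le)
    have "real (\<Sum>e\<in>F. c i e) \<le> b i"
      using F i by (simp add: is_budget_min_cut_def within_budget_def del: of_nat_sum)
    with i(2) have le: "(\<Sum>e\<in>F. c i e) < (\<Sum>e\<in>F'. c i e)"
      by linarith
    show ?thesis using i(1) le by (intro bexI[of _ i]) (auto simp del: sum_nonneg_eq_0_iff)
  qed
  then show ?thesis using F by (auto simp: undominated_def is_budget_min_cut_def)
qed

text \<open>
  By pigeonhole some criterion accounts for a \<open>1 / t\<close> fraction of the components, each of whose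
  boundaries costs at least as much as \<open>F\<close>.
\<close>

lemma obtain_criterion:
  assumes hyp: "hypergraph V E ends" and rank: "\<And>e. e \<in> E \<Longrightarrow> card (ends e) \<le> r"
    and und: "undominated V E ends t c F" and S: "S \<subseteq> E" "F \<inter> S = {}"
    and big: "r * t < num_comps V ends S" and pos: "1 \<le> r" "1 \<le> t"
  obtains i where "i \<in> {1..t}" "0 < (\<Sum>e\<in>crossing E ends S. c i e)"
    "(num_comps V ends S - r * t) * (\<Sum>e\<in>F. c i e)
      \<le> t * (\<Sum>e\<in>crossing E ends S - F. c i e * card (hits V ends S e))"
proof -
  let ?C = "comps V ends S" and ?N = "crossing E ends S"
  let ?cost = "\<lambda>i A. \<Sum>e\<in>A. c i e"
  let ?h = "\<lambda>e. card (hits V ends S e)"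
  have finV: "finite V" and finE: "finite E" using hyp by (auto simp: hypergraph_def)
  have finN: "finite ?N" using finE by (simp add: crossing_def)
  have finC: "finite ?C" using finV by simp
  have cutF: "is_cut V E ends F" using und by (simp add: undominated_def)
  have FN: "F \<subseteq> ?N" using avoiding_cut_crossing[OF hyp S(1) cutF S(2)] .
  define A where "A i = {K \<in> ?C. ?cost i F \<le> ?cost i (delta V E ends K)
      \<and> 0 < ?cost i (delta V E ends K)}" for i
  have "0 < r * t" using pos by simp
  then have two: "2 \<le> card ?C" using big by linarith
  have "?C \<subseteq> (\<Union>i\<in>{1..t}. A i)"
    using und comp_is_cut[OF hyp S(1) _ two] by (fastforce simp: undominated_def A_def)
  moreover have "finite (\<Union>i\<in>{1..t}. A i)" using finC by (auto simp: A_def)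
  ultimately have "card ?C \<le> card (\<Union>i\<in>{1..t}. A i)" by (rule card_mono[rotated])
  also have "\<dots> \<le> (\<Sum>i\<in>{1..t}. card (A i))" by (rule card_UN_le) simp
  finally have sumA: "card ?C \<le> (\<Sum>i\<in>{1..t}. card (A i))" .
  have "\<exists>i\<in>{1..t}. card ?C \<le> t * card (A i)"
  proof (rule ccontr)
    assume "\<not> ?thesis"
    then have "(\<Sum>i\<in>{1..t}. t * card (A i)) < (\<Sum>i\<in>{1..t}. card ?C)"
      using pos by (intro sum_strict_mono) (auto simp: not_le)
    then show False using sumA by (simp add: sum_distrib_left[symmetric])
  qed
  then obtain i where i: "i \<in> {1..t}" "card ?C \<le> t * card (A i)" by blast
  have "A i \<noteq> {}" using i(2) two by auto
  then obtain K where K: "K \<in> A i" by blast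
  then have "delta V E ends K \<subseteq> ?N"
    using delta_comp_subset[of K V ends S E] by (auto simp: A_def)
  then have "?cost i (delta V E ends K) \<le> ?cost i ?N" using finN by (intro sum_mono2) auto
  then have W: "0 < ?cost i ?N" using K by (auto simp: A_def simp del: sum_nonneg_eq_0_iff)
  have "card ?C * ?cost i F \<le> t * (card (A i) * ?cost i F)"
    using mult_le_mono1[OF i(2), of "?cost i F"] by (simp add: ac_simps)
  also have "card (A i) * ?cost i F \<le> (\<Sum>K\<in>A i. ?cost i (delta V E ends K))"
    using sum_bounded_below[of "A i" "?cost i F"] by (simp add: A_def)
  also have "\<dots> \<le> (\<Sum>e\<in>?N. c i e * ?h e)"
    using finV finE by (intro sum_delta_comps_le) (auto simp: A_def)
  also have "\<dots> = (\<Sum>e\<in>?N - F. c i e * ?h e) + (\<Sum>e\<in>F. c i e * ?h e)"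
    using finN FN by (rule sum.subset_diff[rotated])
  \<comment> \<open>The share of \<open>F\<close> itself is at most \<open>r * t\<close> times its
    cost. Moving it to the left side turns \<open>card ?C\<close> into
    \<open>card ?C - r * t\<close>, hence the threshold \<open>r * t\<close>.\<close>
  also have "(\<Sum>e\<in>F. c i e * ?h e) \<le> (\<Sum>e\<in>F. c i e * r)"
  proof (intro sum_mono mult_le_mono2)
    fix e assume "e \<in> F"
    then have "e \<in> E" using cut_subset[OF cutF] by auto
    moreover from this have "finite (ends e)"
      using hyp by (auto simp: hypergraph_def intro: finite_subset)
    ultimately show "?h e \<le> r" using hits_le[of ends e V S] rank[of e] by linarith
  qed
  also have "(\<Sum>e\<in>F. c i e * r) = ?cost i F * r"
    by (rule sum_distrib_right[symmetric])
  finally have "card ?C * ?cost i F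
      \<le> t * (\<Sum>e\<in>?N - F. c i e * ?h e) + r * t * ?cost i F"
    by (simp add: algebra_simps)
  then have "(card ?C - r * t) * ?cost i F \<le> t * (\<Sum>e\<in>?N - F. c i e * ?h e)"
    by (simp add: diff_mult_distrib)
  with i(1) W show ?thesis by (rule that)
qed

text \<open>If \<open>e\<close> is drawn with probability proportional to \<open>c i e\<close>, the
  expectation of \<open>1 / loss\<close>, counted as 0 when \<open>e\<close> lies in
  \<open>F\<close>, does not decrease. Indeed the cost of \<open>F\<close> is spread over the other
  hyperedges as a surcharge factor \<open>1 + ?h e * t / m\<close>, which \<open>loss_step\<close>
  covers.\<close>

lemma obtain_criterion_loss:
  assumes hyp: "hypergraph V E ends" and rank: "\<And>e. e \<in> E \<Longrightarrow> card (ends e) \<le> r"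
    and und: "undominated V E ends t c F" and S: "S \<subseteq> E" "F \<inter> S = {}"
    and big: "r * t < num_comps V ends S" and pos: "1 \<le> r" "1 \<le> t"
  obtains i where "i \<in> {1..t}" "0 < (\<Sum>e\<in>crossing E ends S. c i e)"
    "real (\<Sum>e\<in>crossing E ends S. c i e) / loss r t (num_comps V ends S)
      \<le> (\<Sum>e\<in>crossing E ends S - F. c i e * (1 / loss r t (num_comps V ends (insert e S))))"
proof -
  let ?N = "crossing E ends S" and ?n = "num_comps V ends S"
  let ?h = "\<lambda>e. card (hits V ends S e)" and ?k = "\<lambda>e. num_comps V ends (insert e S)"
  obtain i where i: "i \<in> {1..t}" "0 < (\<Sum>e\<in>?N. c i e)"
    and ineq: "(?n - r * t) * (\<Sum>e\<in>F. c i e) \<le> t * (\<Sum>e\<in>?N - F. c i e * ?h e)"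
    by (rule obtain_criterion[OF assms])
  have finV: "finite V" and finE: "finite E" using hyp by (auto simp: hypergraph_def)
  have finN: "finite ?N" using finE by (simp add: crossing_def)
  have FN: "F \<subseteq> ?N"
    using avoiding_cut_crossing[OF hyp S(1) _ S(2)] und by (simp add: undominated_def)
  define m where "m = real (?n - r * t)"
  have m: "0 < m" using big unfolding m_def of_nat_0_less_iff by simp
  define L where "L = real (loss r t ?n)"
  have L: "0 < L" using loss_pos[OF pos(1)] by (simp add: L_def)
  have step: "(1 + ?h e * t / m) / L \<le> 1 / loss r t (?k e)" if "e \<in> ?N" for e
  proof -
    have e: "e \<in> E" "ends e \<subseteq> V" using that hyp by (auto simp: crossing_def hypergraph_def)
    have "finite (ends e)" using e(2) finV finite_subset by blast
    then have "?h e \<le> r" using hits_le[of ends e V S] rank[OF e(1)] by linarith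
    then have "loss r t (?k e) * (?n - r * t + ?h e * t) \<le> (?n - r * t) * loss r t ?n"
      using big hits_ge_2[OF finV e(2) that] num_comps_insert[OF finV, of ends e S]
      by (intro loss_step) auto
    then have "real (loss r t (?k e)) * (m + ?h e * t) \<le> m * L"
      unfolding m_def L_def by (metis of_nat_add of_nat_le_iff of_nat_mult)
    moreover have "0 < real (loss r t (?k e))" using loss_pos[OF pos(1)] by simp
    ultimately show ?thesis using m L by (simp add: field_simps)
  qed
  have "m * real (\<Sum>e\<in>F. c i e) \<le> t * (\<Sum>e\<in>?N - F. real (c i e) * ?h e)"
    using of_nat_mono[OF ineq, where 'a = real] by (simp add: m_def)
  then have F_le: "real (\<Sum>e\<in>F. c i e) \<le> t / m * (\<Sum>e\<in>?N - F. real (c i e) * ?h e)"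
    using m by (simp add: field_simps)
  have "real (\<Sum>e\<in>?N. c i e) = (\<Sum>e\<in>?N - F. real (c i e)) + real (\<Sum>e\<in>F. c i e)"
    using sum.subset_diff[OF FN finN, of "\<lambda>e. real (c i e)"] by simp
  also have "\<dots> \<le> (\<Sum>e\<in>?N - F. real (c i e)) + t / m * (\<Sum>e\<in>?N - F. real (c i e) * ?h e)"
    using F_le by simp
  also have "\<dots> = (\<Sum>e\<in>?N - F. c i e * (1 + ?h e * t / m))"
    by (simp add: sum.distrib sum_distrib_left algebra_simps)
  finally have "real (\<Sum>e\<in>?N. c i e) / L \<le> (\<Sum>e\<in>?N - F. c i e * (1 + ?h e * t / m)) / L"
    using L by (intro divide_right_mono) auto
  also have "\<dots> = (\<Sum>e\<in>?N - F. c i e * ((1 + ?h e * t / m) / L))"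
    by (simp add: sum_divide_distrib)
  also have "\<dots> \<le> (\<Sum>e\<in>?N - F. c i e * (1 / loss r t (?k e)))"
    using step by (intro sum_mono mult_left_mono) auto
  finally show ?thesis using i by (intro that[of i]) (simp_all add: L_def)
qed

section \<open>Independent contraction orders\<close>

text \<open>The sample space: independent uniform orders are treated by counting in a product. The
  product is extensional so that it is finite for finite \<open>I\<close>.\<close>

definition orders :: "nat set \<Rightarrow> (nat \<Rightarrow> 'a set) \<Rightarrow> (nat \<Rightarrow> 'a list) set" where
  "orders I B = (\<Pi>\<^sub>E i\<in>I. permutations_of_set (B i))"

lemma finite_orders: "finite I \<Longrightarrow> finite (orders I B)"
  by (simp add: orders_def finite_PiE)

lemma card_orders:
  assumes "finite I" "\<And>i. i \<in> I \<Longrightarrow> finite (B i)"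
  shows "card (orders I B) = (\<Prod>i\<in>I. fact (card (B i)))"
  using assms by (simp add: orders_def card_PiE)

text \<open>Each element of \<open>B i\<close> is equally likely to come first in order
  \<open>i\<close>.\<close>

lemma card_orders_remove:
  assumes "finite I" "\<And>i. i \<in> I \<Longrightarrow> finite (B i)" "i \<in> I" "x \<in> B i"
  shows "card (orders I B) = card (B i) * card (orders I (B(i := B i - {x})))"
proof -
  have "card (B i) = Suc (card (B i - {x}))"
    using assms by (metis card_Suc_Diff1)
  then have "fact (card (B i)) = card (B i) * fact (card (B i - {x}))"
    by (metis fact_Suc of_nat_id)
  moreover have "(\<Prod>j\<in>I - {i}. fact (card ((B(i := B i - {x})) j)))
      = (\<Prod>j\<in>I - {i}. fact (card (B j)) :: nat)"
    by (rule prod.cong) auto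
  ultimately show ?thesis
    using assms by (simp add: card_orders prod.remove[of I i] del: card_Diff_insert card_Diff_singleton)
qed

text \<open>Conditioning on the first entry of order \<open>i\<close>: prepending \<open>x\<close>
  is injective, and different \<open>x\<close> give different orders.\<close>

lemma sum_card_orders_first_le:
  assumes "finite I" "\<And>i. i \<in> I \<Longrightarrow> finite (B i)" "i \<in> I" "X \<subseteq> B i"
  shows "(\<Sum>x\<in>X. card {\<omega> \<in> orders I (B(i := B i - {x})). P (\<omega>(i := x # \<omega> i))})
    \<le> card {\<omega> \<in> orders I B. P \<omega>}"
proof -
  let ?A = "\<lambda>x. {\<omega> \<in> orders I (B(i := B i - {x})). P (\<omega>(i := x # \<omega> i))}"
  let ?f = "\<lambda>(x, \<omega>). \<omega>(i := x # \<omega> i)"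
  have finX: "finite X" using assms finite_subset by blast
  have "(\<Sum>x\<in>X. card (?A x)) = card (Sigma X ?A)"
    using finX by (intro card_SigmaI[symmetric]) (auto simp: finite_orders assms(1))
  also have "\<dots> \<le> card {\<omega> \<in> orders I B. P \<omega>}"
  proof (rule card_inj_on_le[of ?f])
    show "inj_on ?f (Sigma X ?A)"
    proof (rule inj_onI, clarify)
      fix x y \<omega> \<omega>'
      assume eq: "\<omega>(i := x # \<omega> i) = \<omega>'(i := y # \<omega>' i)"
      then have "x = y \<and> \<omega> i = \<omega>' i" by (metis fun_upd_same list.inject)
      moreover from eq have "\<omega> j = \<omega>' j" if "j \<noteq> i" for j
        using that by (metis fun_upd_other)
      ultimately show "x = y \<and> \<omega> = \<omega>'" by (metis ext)
    qed
    show "?f ` Sigma X ?A \<subseteq> {\<omega> \<in> orders I B. P \<omega>}"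
    proof clarify
      fix x \<omega>
      assume x: "x \<in> X" and \<omega>: "\<omega> \<in> orders I (B(i := B i - {x}))" and "P (\<omega>(i := x # \<omega> i))"
      have mem: "\<omega> j \<in> permutations_of_set ((B(i := B i - {x})) j)" if "j \<in> I" for j
        using \<omega> that unfolding orders_def by (rule PiE_mem)
      have "x # \<omega> i \<in> permutations_of_set (B i)"
        using mem[OF assms(3)] x assms(4) by (auto simp: permutations_of_set_def)
      moreover have "\<omega> j \<in> permutations_of_set (B j)" if "j \<in> I" "j \<noteq> i" for j
        using mem[OF that(1)] that(2) by simp
      moreover have "\<omega> \<in> extensional I" using \<omega> by (auto simp: orders_def PiE_def)
      ultimately show "\<omega>(i := x # \<omega> i) \<in> orders I B"
        using assms(3) by (auto simp: orders_def PiE_def extensional_def)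
    qed
    show "finite {\<omega> \<in> orders I B. P \<omega>}" using assms(1) by (simp add: finite_orders)
  qed
  finally show ?thesis .
qed

text \<open>
  Repeating \<open>e\<close> according to its \<open>i\<close>-th cost makes a uniformly random order of the tokens draw
  hyperedges with probability proportional to \<open>c i\<close>.
\<close>

definition tokens :: "(nat \<Rightarrow> 'e \<Rightarrow> nat) \<Rightarrow> 'e set \<Rightarrow> nat \<Rightarrow> ('e \<times> nat) set" where
  "tokens c E i = (SIGMA e:E. {..<c i e})"

definition prefix_edges :: "nat set \<Rightarrow> (nat \<Rightarrow> nat) \<Rightarrow> (nat \<Rightarrow> ('e \<times> nat) list) \<Rightarrow> 'e set" where
  "prefix_edges I m \<omega> = (\<Union>i\<in>I. fst ` set (take (m i) (\<omega> i)))"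

text \<open>A strategy that adapts to \<open>F\<close> enters only through the prefix lengths
  \<open>m\<close> at which it stops, since the interleaving of the orders does not affect the
  contracted set. The existential quantifier hides the strategy.\<close>

definition survives ::
  "'v set \<Rightarrow> ('e \<Rightarrow> 'v set) \<Rightarrow> nat set \<Rightarrow> nat \<Rightarrow> 'e set \<Rightarrow> 'e set \<Rightarrow> (nat \<Rightarrow> ('e \<times> nat) list) \<Rightarrow> bool"
where
  "survives V ends I T S F \<omega> \<longleftrightarrow>
     (\<exists>m. num_comps V ends (S \<union> prefix_edges I m \<omega>) \<le> T \<and> F \<inter> (S \<union> prefix_edges I m \<omega>) = {})"

text \<open>Lengthening the \<open>i\<close>-th prefix by one accounts for the prepended token, so
  the contracted set is the same.\<close>

lemma survives_first:
  assumes "survives V ends I T (insert (fst x) S) F \<omega>" "i \<in> I"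
  shows "survives V ends I T S F (\<omega>(i := x # \<omega> i))"
proof -
  obtain m where m: "num_comps V ends (insert (fst x) S \<union> prefix_edges I m \<omega>) \<le> T"
    "F \<inter> (insert (fst x) S \<union> prefix_edges I m \<omega>) = {}"
    using assms(1) by (auto simp: survives_def)
  have "fst ` set (take ((m(i := Suc (m i))) j) ((\<omega>(i := x # \<omega> i)) j))
      = (if j = i then {fst x} else {}) \<union> fst ` set (take (m j) (\<omega> j))" for j
    by simp
  then have "prefix_edges I (m(i := Suc (m i))) (\<omega>(i := x # \<omega> i))
      = (\<Union>j\<in>I. if j = i then {fst x} else {}) \<union> prefix_edges I m \<omega>"
    unfolding prefix_edges_def UN_Un_distrib[symmetric] by (rule SUP_cong[OF refl])
  moreover have "(\<Union>j\<in>I. if j = i then {fst x} else {}) = {fst x}"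
    using assms(2) by auto
  ultimately have "S \<union> prefix_edges I (m(i := Suc (m i))) (\<omega>(i := x # \<omega> i))
      = insert (fst x) S \<union> prefix_edges I m \<omega>"
    by simp
  then show ?thesis using m unfolding survives_def by metis
qed

lemma sum_tokens:
  assumes "finite E" "N \<subseteq> E"
  shows "(\<Sum>x\<in>{x \<in> tokens c E i. fst x \<in> N}. g (fst x)) = (\<Sum>e\<in>N. real (c i e) * g e)"
proof -
  have "{x \<in> tokens c E i. fst x \<in> N} = (SIGMA e:N. {..<c i e})"
    using assms(2) by (auto simp: tokens_def)
  then have "(\<Sum>x\<in>{x \<in> tokens c E i. fst x \<in> N}. g (fst x)) = (\<Sum>(e, k)\<in>(SIGMA e:N. {..<c i e}). g e)"
    by (simp add: case_prod_unfold)
  also have "\<dots> = (\<Sum>e\<in>N. \<Sum>k<c i e. g e)"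
    using finite_subset[OF assms(2,1)] by (intro sum.Sigma[symmetric]) auto
  finally show ?thesis by simp
qed

text \<open>The pool \<open>B i\<close> may also hold tokens of loops. These are harmless: loops are
  not in \<open>F\<close>, and drawing one cannot increase the loss, so each contributes at least
  its share.\<close>

lemma obtain_criterion_tokens:
  assumes hyp: "hypergraph V E ends" and rank: "\<And>e. e \<in> E \<Longrightarrow> card (ends e) \<le> r"
    and und: "undominated V E ends t c F" and S: "S \<subseteq> E" "F \<inter> S = {}"
    and big: "r * t < num_comps V ends S" and pos: "1 \<le> r" "1 \<le> t"
    and B: "\<And>i. i \<in> {1..t} \<Longrightarrow> B i \<subseteq> tokens c E i"
      "\<And>i. i \<in> {1..t} \<Longrightarrow> {x \<in> tokens c E i. fst x \<in> crossing E ends S} \<subseteq> B i"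
  obtains i where "i \<in> {1..t}" "B i \<noteq> {}"
    "card (B i) / loss r t (num_comps V ends S)
      \<le> (\<Sum>x\<in>{x \<in> B i. fst x \<notin> F}. 1 / loss r t (num_comps V ends (insert (fst x) S)))"
proof -
  let ?N = "crossing E ends S" and ?L = "real (loss r t (num_comps V ends S))"
  let ?g = "\<lambda>e. 1 / real (loss r t (num_comps V ends (insert e S)))"
  obtain i where i: "i \<in> {1..t}" "0 < (\<Sum>e\<in>?N. c i e)"
    and ineq: "real (\<Sum>e\<in>?N. c i e) / ?L \<le> (\<Sum>e\<in>?N - F. c i e * ?g e)"
    by (rule obtain_criterion_loss[OF assms(1-8)])
  have finV: "finite V" and finE: "finite E" using hyp by (auto simp: hypergraph_def)
  have NE: "?N \<subseteq> E" by (auto simp: crossing_def)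
  have FN: "F \<subseteq> ?N"
    using avoiding_cut_crossing[OF hyp S(1) _ S(2)] und by (simp add: undominated_def)
  have finB: "finite (B i)"
    using B(1)[OF i(1)] finE by (auto simp: tokens_def intro: finite_subset)
  let ?X = "{x \<in> B i. fst x \<in> ?N}" and ?Y = "{x \<in> B i. fst x \<notin> ?N}"
  have X: "?X = {x \<in> tokens c E i. fst x \<in> ?N}" using B i(1) by blast
  have X': "{x \<in> ?X. fst x \<notin> F} = {x \<in> tokens c E i. fst x \<in> ?N - F}" using X by blast
  have "real (card ?X) = (\<Sum>x\<in>{x \<in> tokens c E i. fst x \<in> ?N}. 1)" using X by simp
  also have "\<dots> = real (\<Sum>e\<in>?N. c i e)"
    using sum_tokens[OF finE NE, where g = "\<lambda>_. 1" and c = c and i = i] by simp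
  finally have cX: "real (card ?X) = real (\<Sum>e\<in>?N. c i e)" .
  have "B i = ?X \<union> ?Y" by blast
  then have "card (B i) = card ?X + card ?Y"
    using finB card_Un_disjoint[of ?X ?Y] by fastforce
  then have "card (B i) / ?L = real (\<Sum>e\<in>?N. c i e) / ?L + card ?Y * (1 / ?L)"
    using cX by (simp add: add_divide_distrib)
  also have "\<dots> \<le> (\<Sum>e\<in>?N - F. c i e * ?g e) + (\<Sum>x\<in>?Y. ?g (fst x))"
  proof (rule add_mono[OF ineq])
    have "1 / ?L \<le> ?g e" for e
      using loss_mono[OF pos(1) num_comps_antimono[OF finV subset_insertI[of S e]], of t ends]
        loss_pos[OF pos(1)] by (intro divide_left_mono) auto
    then show "card ?Y * (1 / ?L) \<le> (\<Sum>x\<in>?Y. ?g (fst x))"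
      using sum_bounded_below[of ?Y "1 / ?L" "\<lambda>x. ?g (fst x)"] by simp
  qed
  also have "(\<Sum>e\<in>?N - F. c i e * ?g e) = (\<Sum>x\<in>{x \<in> ?X. fst x \<notin> F}. ?g (fst x))"
    unfolding X' using NE by (intro sum_tokens[OF finE, symmetric]) auto
  also have "\<dots> + (\<Sum>x\<in>?Y. ?g (fst x)) = (\<Sum>x\<in>{x \<in> ?X. fst x \<notin> F} \<union> ?Y. ?g (fst x))"
    using finB by (intro sum.union_disjoint[symmetric]) auto
  also have "{x \<in> ?X. fst x \<notin> F} \<union> ?Y = {x \<in> B i. fst x \<notin> F}" using FN by blast
  finally have "card (B i) / ?L \<le> (\<Sum>x\<in>{x \<in> B i. fst x \<notin> F}. ?g (fst x))" .
  moreover have "B i \<noteq> {}"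
  proof
    assume "B i = {}"
    then have "?X = {}" by blast
    then have "card ?X = 0" by (simp only: card.empty)
    then show False using cX i(2) by (simp del: of_nat_sum)
  qed
  ultimately show ?thesis using i(1) that by blast
qed

text \<open>
  The criterion to advance may depend on \<open>F\<close> and on the hyperedges seen so far: whatever the choice,
  the next token of that order is uniform among the tokens not yet drawn.
\<close>

lemma card_surviving_orders:
  assumes hyp: "hypergraph V E ends" and rank: "\<And>e. e \<in> E \<Longrightarrow> card (ends e) \<le> r"
    and und: "undominated V E ends t c F" and pos: "1 \<le> r" "1 \<le> t"
    and "S \<subseteq> E" "F \<inter> S = {}"
    and "\<And>i. i \<in> {1..t} \<Longrightarrow> B i \<subseteq> tokens c E i"
    and "\<And>i. i \<in> {1..t} \<Longrightarrow> {x \<in> tokens c E i. fst x \<in> crossing E ends S} \<subseteq> B i"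
  shows "card (orders {1..t} B) / loss r t (num_comps V ends S)
    \<le> card {\<omega> \<in> orders {1..t} B. survives V ends {1..t} (r * t) S F \<omega>}"
  using assms(6-)
proof (induction "\<Sum>i\<in>{1..t}. card (B i)" arbitrary: B S rule: less_induct)
  case less
  note S = less.prems(1,2) and B = less.prems(3,4)
  let ?surv = "survives V ends {1..t} (r * t)"
  let ?n = "num_comps V ends S"
  have finE: "finite E" using hyp by (auto simp: hypergraph_def)
  have finB: "finite (B i)" if "i \<in> {1..t}" for i
    using B(1)[OF that] finE by (auto simp: tokens_def intro: finite_subset)
  show ?case
  proof (cases "?n \<le> r * t")
    case True
    \<comment> \<open>At the threshold, empty prefixes witness survival in every order, matching the
      loss of 1.\<close>
    have "S \<union> prefix_edges {1..t} (\<lambda>_. 0) \<omega> = S" for \<omega> :: "nat \<Rightarrow> ('b \<times> nat) list"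
      by (simp add: prefix_edges_def)
    then have "?surv S F \<omega>" for \<omega>
      using True S(2) unfolding survives_def by metis
    then show ?thesis using True by (simp add: loss_def)
  next
    case False
    then have big: "r * t < ?n" by simp
    obtain i where i: "i \<in> {1..t}" "B i \<noteq> {}"
      and ineq: "card (B i) / loss r t ?n
        \<le> (\<Sum>x\<in>{x \<in> B i. fst x \<notin> F}. 1 / loss r t (num_comps V ends (insert (fst x) S)))"
      by (rule obtain_criterion_tokens[OF hyp rank und S big pos B])
    let ?X = "{x \<in> B i. fst x \<notin> F}" and ?B = "\<lambda>x. B(i := B i - {x})"
    let ?l = "\<lambda>x. real (loss r t (num_comps V ends (insert (fst x) S)))"
    have IH: "card (orders {1..t} (?B x)) / ?l x
        \<le> card {\<omega> \<in> orders {1..t} (?B x). ?surv (insert (fst x) S) F \<omega>}" if x: "x \<in> ?X" for x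
    proof (rule less.hyps)
      show "(\<Sum>j\<in>{1..t}. card (?B x j)) < (\<Sum>j\<in>{1..t}. card (B j))"
      proof (rule sum_strict_mono_ex1)
        show "\<forall>j\<in>{1..t}. card (?B x j) \<le> card (B j)"
          using finB[OF i(1)] by (auto intro: card_mono)
        show "\<exists>j\<in>{1..t}. card (?B x j) < card (B j)"
          using i(1) x card_Diff1_less[OF finB[OF i(1)], of x] by (intro bexI[of _ i]) simp_all
      qed simp
      have "fst x \<in> E" using x B(1)[OF i(1)] by (auto simp: tokens_def)
      then show "insert (fst x) S \<subseteq> E" using S by simp
      show "F \<inter> insert (fst x) S = {}" using S x by simp
      show "?B x j \<subseteq> tokens c E j" if "j \<in> {1..t}" for j
        using B(1)[OF that] by auto
      \<comment> \<open>Only \<open>x\<close> leaves the pool, and its hyperedge is a loop from now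
        on, so every token of a crossing hyperedge is still available.\<close>
      show "{y \<in> tokens c E j. fst y \<in> crossing E ends (insert (fst x) S)} \<subseteq> ?B x j"
        if "j \<in> {1..t}" for j
        using B(2)[OF that] crossing_antimono[of S "insert (fst x) S" E ends]
          crossing_disjoint[of E ends "insert (fst x) S"] by fastforce
    qed
    have cB: "0 < real (card (B i))" using i finB by (simp add: card_gt_0_iff)
    \<comment> \<open>The number of continuations after a first token, the same for every token; it
      scales the one-step inequality to counts of orders.\<close>
    let ?M = "real (card (orders {1..t} B)) / card (B i)"
    have M: "real (card (orders {1..t} (?B x))) = ?M" if "x \<in> ?X" for x
    proof -
      have "card (orders {1..t} B) = card (B i) * card (orders {1..t} (?B x))"
        using that finB i(1) by (intro card_orders_remove) auto
      then show ?thesis using cB by (metis nonzero_mult_div_cancel_left of_nat_mult less_irrefl)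
    qed
    have "card (orders {1..t} B) / loss r t ?n = ?M * (card (B i) / loss r t ?n)"
      using cB by simp
    also have "\<dots> \<le> ?M * (\<Sum>x\<in>?X. 1 / ?l x)"
      using ineq by (intro mult_left_mono) auto
    also have "\<dots> = (\<Sum>x\<in>?X. card (orders {1..t} (?B x)) / ?l x)"
      using M by (simp add: sum_distrib_left)
    also have "\<dots> \<le> (\<Sum>x\<in>?X. real (card {\<omega> \<in> orders {1..t} (?B x). ?surv S F (\<omega>(i := x # \<omega> i))}))"
    proof (rule sum_mono)
      fix x assume x: "x \<in> ?X"
      have "card {\<omega> \<in> orders {1..t} (?B x). ?surv (insert (fst x) S) F \<omega>}
          \<le> card {\<omega> \<in> orders {1..t} (?B x). ?surv S F (\<omega>(i := x # \<omega> i))}"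
      proof (rule card_mono)
        show "{\<omega> \<in> orders {1..t} (?B x). ?surv (insert (fst x) S) F \<omega>}
            \<subseteq> {\<omega> \<in> orders {1..t} (?B x). ?surv S F (\<omega>(i := x # \<omega> i))}"
          using survives_first[OF _ i(1)] by blast
      qed (simp add: finite_orders)
      then show "card (orders {1..t} (?B x)) / ?l x
          \<le> real (card {\<omega> \<in> orders {1..t} (?B x). ?surv S F (\<omega>(i := x # \<omega> i))})"
        using IH[OF x] by linarith
    qed
    also have "\<dots> \<le> card {\<omega> \<in> orders {1..t} B. ?surv S F \<omega>}"
      using sum_card_orders_first_le[of "{1..t}" B i ?X "?surv S F"] finB i(1)
      unfolding of_nat_sum[symmetric] of_nat_le_iff by blast
    finally show ?thesis .
  qed
qed

section \<open>Cuts surviving in fixed contraction orders\<close>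

text \<open>
  A chain of contractions passes through at most \<open>card V\<close> partitions. The prefix of the last order
  need not be guessed: the shortest one that reaches \<open>T\<close> components will do, which saves one factor
  \<open>card V\<close>.
\<close>

lemma card_cuts_avoiding_chains:
  fixes p :: "nat \<Rightarrow> nat \<Rightarrow> 'e set"
  assumes hyp: "hypergraph V E ends" and "1 \<le> t" "V \<noteq> {}"
    and mono: "\<And>i. mono (p i)" and sub: "\<And>i j. i \<in> {1..t} \<Longrightarrow> p i j \<subseteq> E"
  shows "card {F. is_cut V E ends F \<and>
      (\<exists>m. num_comps V ends (\<Union>i\<in>{1..t}. p i (m i)) \<le> T \<and> F \<inter> (\<Union>i\<in>{1..t}. p i (m i)) = {})}
    \<le> card V ^ (t - 1) * 2 ^ T" (is "card ?G \<le> _")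
proof -
  have finV: "finite V" and finE: "finite E" using hyp by (auto simp: hypergraph_def)
  have ends_sub: "\<And>e. e \<in> E \<Longrightarrow> ends e \<subseteq> V" using hyp by (auto simp: hypergraph_def)
  \<comment> \<open>Enlarging a prefix to all the hyperedges it turns into loops loses no cut
    avoiding the prefix, and the result depends only on the number of components.\<close>
  define D where "D i j = E - crossing E ends (p i j)" for i j
  define k where "k i j = num_comps V ends (p i j)" for i j
  have D_k: "D i j = D i j'" if "k i j = k i j'" for i j j'
  proof (cases "j \<le> j'")
    case True
    then show ?thesis using that crossing_eq_if_num_comps_eq[OF finV ends_sub monoD[OF mono True]]
      by (simp add: D_def k_def)
  next
    case False
    then have "j' \<le> j" by simp
    then show ?thesis using that crossing_eq_if_num_comps_eq[OF finV ends_sub monoD[OF mono]]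
      by (simp add: D_def k_def)
  qed
  have card_D: "finite (range (D i)) \<and> card (range (D i)) \<le> card V" for i
  proof -
    have "comps V ends (p i j) \<noteq> {}" for j using assms(3) by (simp add: comps_def)
    \<comment> \<open>Since \<open>V\<close> is nonempty the count is never 0, which leaves
      \<open>card V\<close> values and not \<open>card V + 1\<close>.\<close>
    then have k_range: "range (k i) \<subseteq> {1..card V}"
      using finV num_comps_le[OF finV] by (auto simp: k_def Suc_le_eq card_gt_0_iff)
    then have fin: "finite (range (k i))" by (rule finite_subset) simp
    have eq: "range (D i) = (\<lambda>n. D i (SOME j. k i j = n)) ` range (k i)"
    proof -
      have "D i (SOME j'. k i j' = k i j) = D i j" for j
        by (rule D_k) (rule someI[of _ j], simp)
      then show ?thesis by (simp add: image_image)
    qed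
    have "card (range (D i)) \<le> card (range (k i))" unfolding eq using fin by (rule card_image_le)
    also have "\<dots> \<le> card V" using card_mono[OF _ k_range] by simp
    finally show ?thesis using fin eq by simp
  qed
  have p_D: "p i j \<subseteq> D i j" if "i \<in> {1..t}" for i j
    using sub[OF that] crossing_disjoint[of E ends "p i j"] by (auto simp: D_def)
  define R where "R = (\<Pi>\<^sub>E i\<in>{1..<t}. range (D i))"
  have finR: "finite R" unfolding R_def using card_D by (intro finite_PiE) auto
  define reach where "reach d j = (\<Union>i\<in>{1..<t}. d i) \<union> p t j" for d j
  define S where "S d = reach d (LEAST j. num_comps V ends (reach d j) \<le> T)" for d
  \<comment> \<open>If no prefix of the last order reaches \<open>T\<close>, the
    \<open>LEAST\<close> above is arbitrary; the condition on \<open>num_comps\<close> then makes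
    \<open>G d\<close> empty.\<close>
  define G where "G d = {F. is_cut V E ends F \<and> num_comps V ends (S d) \<le> T \<and> F \<inter> S d = {}}" for d
  have "card R = (\<Prod>i\<in>{1..<t}. card (range (D i)))" by (simp add: R_def card_PiE)
  also have "\<dots> \<le> (\<Prod>i\<in>{1..<t}. card V)" using card_D by (intro prod_mono) auto
  finally have cR: "card R \<le> card V ^ (t - 1)" by simp
  have S_sub: "S d \<subseteq> E" if "d \<in> R" for d
  proof -
    have "d i \<subseteq> E" if "i \<in> {1..<t}" for i
      using \<open>d \<in> R\<close> that by (auto simp: R_def D_def dest!: PiE_mem)
    then show ?thesis
      using sub[of t] assms(2) unfolding S_def reach_def by (intro Un_least UN_least) auto
  qed
  have G_le: "card (G d) \<le> 2 ^ T" if "d \<in> R" for d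
  proof (cases "num_comps V ends (S d) \<le> T")
    case True
    then have "card (G d) \<le> 2 ^ num_comps V ends (S d)"
      using card_avoiding_cuts[OF hyp S_sub[OF that]] by (simp add: G_def)
    also have "\<dots> \<le> 2 ^ T" using True by (intro power_increasing) auto
    finally show ?thesis .
  qed (simp add: G_def)
  have "?G \<subseteq> (\<Union>d\<in>R. G d)"
  proof clarify
    fix F m
    let ?P = "\<Union>i\<in>{1..t}. p i (m i)"
    assume F: "is_cut V E ends F" and T: "num_comps V ends ?P \<le> T" and disj: "F \<inter> ?P = {}"
    define d where "d = (\<lambda>i\<in>{1..<t}. D i (m i))"
    have d: "d \<in> R" by (auto simp: d_def R_def)
    have "?P \<subseteq> reach d (m t)"
    proof
      fix e assume "e \<in> ?P"
      then obtain i where i: "i \<in> {1..t}" "e \<in> p i (m i)" by blast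
      show "e \<in> reach d (m t)"
      proof (cases "i = t")
        case False
        then show ?thesis using i p_D[OF i(1), of "m i"] by (auto simp: reach_def d_def)
      qed (use i in \<open>simp add: reach_def\<close>)
    qed
    then have mt: "num_comps V ends (reach d (m t)) \<le> T"
      using num_comps_antimono[OF finV, of ?P "reach d (m t)" ends] T by linarith
    let ?j = "LEAST j. num_comps V ends (reach d j) \<le> T"
    have "F \<inter> d i = {}" if "i \<in> {1..<t}" for i
    proof -
      have "F \<subseteq> crossing E ends (p i (m i))"
      proof (rule avoiding_cut_crossing[OF hyp _ F])
        have "p i (m i) \<subseteq> ?P" using that by (intro UN_upper) simp
        then show "F \<inter> p i (m i) = {}" using disj by blast
      qed (use that sub in simp)
      then show ?thesis using that by (auto simp: D_def d_def)
    qed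
    \<comment> \<open>The shortest sufficient prefix lies inside the one known to avoid
      \<open>F\<close>, so it avoids \<open>F\<close> too.\<close>
    moreover have "?j \<le> m t" using mt by (rule Least_le)
    then have "p t ?j \<subseteq> p t (m t)" using mono by (auto dest: monoD)
    then have "F \<inter> p t ?j = {}" using disj assms(2) by fastforce
    ultimately have "F \<inter> S d = {}"
      unfolding S_def reach_def by (simp add: Int_Un_distrib Int_UN_distrib)
    moreover have "num_comps V ends (S d) \<le> T" unfolding S_def using mt by (rule LeastI)
    ultimately have "F \<in> G d" using F by (simp add: G_def)
    with d show "F \<in> (\<Union>d\<in>R. G d)" by blast
  qed
  moreover have "finite (\<Union>d\<in>R. G d)"
  proof (rule finite_subset)
    show "(\<Union>d\<in>R. G d) \<subseteq> Pow E" by (auto simp: G_def dest: cut_subset)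
  qed (use finE in simp)
  ultimately have "card ?G \<le> card (\<Union>d\<in>R. G d)" by (rule card_mono[rotated])
  also have "\<dots> \<le> (\<Sum>d\<in>R. card (G d))" using finR by (rule card_UN_le)
  also have "\<dots> \<le> card R * 2 ^ T" using G_le sum_bounded_above[of R "\<lambda>d. card (G d)" "2 ^ T"] by simp
  also have "\<dots> \<le> card V ^ (t - 1) * 2 ^ T" using cR by simp
  finally show ?thesis .
qed

lemma card_surviving_cuts:
  assumes "hypergraph V E ends" "1 \<le> t" "V \<noteq> {}" "\<omega> \<in> orders {1..t} (tokens c E)"
  shows "card {F. is_cut V E ends F \<and> survives V ends {1..t} T {} F \<omega>} \<le> card V ^ (t - 1) * 2 ^ T"
proof -
  let ?p = "\<lambda>i j. fst ` set (take j (\<omega> i))"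
  have "mono (?p i)" for i by (intro monoI image_mono set_take_subset_set_take)
  moreover have "?p i j \<subseteq> E" if "i \<in> {1..t}" for i j
  proof -
    have "\<omega> i \<in> permutations_of_set (tokens c E i)"
      using assms(4) that by (auto simp: orders_def)
    then have "set (\<omega> i) = tokens c E i" by (rule permutations_of_setD)
    then show ?thesis using set_take_subset[of j "\<omega> i"] by (auto simp: tokens_def)
  qed
  ultimately show ?thesis
    using card_cuts_avoiding_chains[OF assms(1-3), of ?p T]
    by (simp add: survives_def prefix_edges_def)
qed

section \<open>Double counting of cuts and orders, and the final bound\<close>

lemma card_undominated_cuts:
  assumes hyp: "hypergraph V E ends" and rank: "\<And>e. e \<in> E \<Longrightarrow> card (ends e) \<le> r"
    and pos: "1 \<le> r" "1 \<le> t" and "V \<noteq> {}"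
  shows "card {F. undominated V E ends t c F} \<le> loss r t (card V) * (card V ^ (t - 1) * 2 ^ (r * t))"
proof -
  let ?U = "{F. undominated V E ends t c F}" and ?O = "orders {1..t} (tokens c E)"
  let ?surv = "survives V ends {1..t} (r * t) {}"
  let ?M = "card V ^ (t - 1) * 2 ^ (r * t)"
  have finE: "finite E" using hyp by (auto simp: hypergraph_def)
  have cuts: "{F. is_cut V E ends F} \<subseteq> Pow E" by (auto dest: cut_subset)
  have finC: "finite {F. is_cut V E ends F}" using finite_subset[OF cuts] finE by simp
  have finU: "finite ?U" by (rule finite_subset[OF _ finC]) (auto simp: undominated_def)
  have finO: "finite ?O" by (rule finite_orders) simp
  have "finite (tokens c E i)" for i using finE by (simp add: tokens_def)
  then have posO: "0 < card ?O" by (simp add: card_orders prod_pos)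
  have posL: "0 < real (loss r t (card V))" using loss_pos[OF pos(1)] by simp
  \<comment> \<open>Pairs of an undominated cut and an order it survives are counted: each cut has
    at least a \<open>1 / loss\<close> fraction of the orders, each order at most \<open>?M\<close>
    cuts.\<close>
  have "card ?U * (card ?O / loss r t (card V)) \<le> (\<Sum>F\<in>?U. real (card {\<omega> \<in> ?O. ?surv F \<omega>}))"
  proof (rule sum_bounded_below)
    fix F assume "F \<in> ?U"
    then show "card ?O / loss r t (card V) \<le> real (card {\<omega> \<in> ?O. ?surv F \<omega>})"
      using card_surviving_orders[OF hyp rank _ pos, of c F "{}" "tokens c E"] by simp
  qed
  also have "\<dots> = real (\<Sum>F\<in>?U. \<Sum>\<omega>\<in>{\<omega> \<in> ?O. ?surv F \<omega>}. 1)" by simp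
  also have "\<dots> = real (\<Sum>\<omega>\<in>?O. \<Sum>F\<in>{F \<in> ?U. ?surv F \<omega>}. 1)"
    using sum.swap_restrict[OF finU finO, of "\<lambda>_ _. 1::nat" "\<lambda>F \<omega>. ?surv F \<omega>"] by simp
  also have "\<dots> = (\<Sum>\<omega>\<in>?O. real (card {F \<in> ?U. ?surv F \<omega>}))" by simp
  also have "\<dots> \<le> card ?O * real ?M"
  proof (rule sum_bounded_above)
    fix \<omega> assume \<omega>: "\<omega> \<in> ?O"
    have "card {F \<in> ?U. ?surv F \<omega>} \<le> card {F. is_cut V E ends F \<and> ?surv F \<omega>}"
      by (rule card_mono) (auto simp: undominated_def intro: finite_subset[OF _ finC])
    also have "\<dots> \<le> ?M" by (rule card_surviving_cuts[OF hyp pos(2) assms(5) \<omega>])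
    finally show "real (card {F \<in> ?U. ?surv F \<omega>}) \<le> real ?M" by (rule of_nat_mono)
  qed
  finally have "real (card ?U) \<le> loss r t (card V) * real ?M"
    using posO posL by (simp add: field_simps)
  then show ?thesis unfolding of_nat_mult[symmetric] of_nat_le_iff .
qed

text \<open>For \<open>r >= 2\<close> the shift by \<open>r * t\<close> outweighs the added
  \<open>2 * t\<close>, so the upper index of the binomial is at most \<open>n\<close>.\<close>

lemma loss_le:
  assumes "2 \<le> r" "1 \<le> n"
  shows "loss r t n \<le> r * n ^ (2 * t)"
proof (cases "n \<le> r * t")
  case True
  have "1 * 1 \<le> r * n ^ (2 * t)" using assms by (intro mult_le_mono) auto
  then show ?thesis using True by (simp add: loss_def)
next
  case False
  have "2 * t \<le> r * t" using assms by simp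
  then have "(n - r * t + 2 * t) choose (2 * t) \<le> n choose (2 * t)"
    using False by (intro binomial_right_mono) linarith
  also have "\<dots> \<le> n ^ (2 * t)"
    using \<open>2 * t \<le> r * t\<close> False by (intro binomial_le_pow) linarith
  finally show ?thesis using False by (simp add: loss_def)
qed

lemma card_multiobjective_min_cuts:
  assumes hyp: "hypergraph V E ends" and rank: "\<And>e. e \<in> E \<Longrightarrow> card (ends e) \<le> r"
    and pos: "1 \<le> r" "1 \<le> t" and free: "no_free_cut V E ends (c t)"
  shows "card {F. is_multiobjective_min_cut V E ends t c F} \<le> r * 2 ^ (r * t) * card V ^ (3 * t - 1)"
    (is "card ?M \<le> ?R")
proof (cases "?M = {}")
  case False
  then obtain F where F: "is_cut V E ends F"
    by (auto simp: is_multiobjective_min_cut_def is_budget_min_cut_def)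
  have finV: "finite V" using hyp by (simp add: hypergraph_def)
  have V: "V \<noteq> {}" using F by (auto simp: is_cut_def)
  then have n: "1 \<le> card V" using finV by (simp add: Suc_le_eq card_gt_0_iff)
  show ?thesis
  proof (cases "is_cut V E ends {}")
    case True
    \<comment> \<open>The empty cut is free and fits every budget, so a multiobjective min-cut has
      \<open>c t\<close>-cost 0 and is empty by \<open>no_free_cut\<close>.\<close>
    have "?M \<subseteq> {{}}"
    proof
      fix F assume "F \<in> ?M"
      then obtain b where b: "\<forall>i\<in>{1..<t}. 0 \<le> b i" "is_budget_min_cut V E ends t c b F"
        by (auto simp: is_multiobjective_min_cut_def)
      then have "within_budget t c b {}" by (simp add: within_budget_def)
      then have "(\<Sum>e\<in>F. c t e) \<le> (\<Sum>e\<in>{}. c t e)"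
        using b(2) True unfolding is_budget_min_cut_def by blast
      moreover have "is_cut V E ends F" using b(2) by (simp add: is_budget_min_cut_def)
      then have "F \<noteq> {} \<Longrightarrow> 0 < (\<Sum>e\<in>F. c t e)"
        using free unfolding no_free_cut_def by blast
      ultimately show "F \<in> {{}}" by force
    qed
    then have "card ?M \<le> 1" using card_mono[of "{{}}" ?M] by simp
    also have "1 * 1 * 1 \<le> ?R" using pos n by (intro mult_le_mono) auto
    then have "1 \<le> ?R" by simp
    finally show ?thesis .
  next
    case no_empty: False
    \<comment> \<open>A nonempty cut contains a hyperedge with vertices on both sides, which gives
      the \<open>2 <= r\<close> needed for \<open>loss_le\<close>.\<close>
    then obtain e where e: "e \<in> F" using F by (metis all_not_in_conv)
    then obtain x y where xy: "x \<in> ends e" "y \<in> ends e" "x \<noteq> y" "e \<in> E"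
      using F by (auto simp: is_cut_def delta_def)
    have "finite (ends e)" using hyp xy by (auto simp: hypergraph_def intro: finite_subset)
    then have "card {x, y} \<le> card (ends e)" using xy by (intro card_mono) auto
    then have r: "2 \<le> r" using rank[OF xy(4)] xy(3) by simp
    have "?M \<subseteq> {F. undominated V E ends t c F}"
      using multiobjective_min_cut_undominated[of V E ends t c, OF _ pos(2) free no_empty] by blast
    moreover have "finite {F. undominated V E ends t c F}"
    proof (rule finite_subset)
      show "{F. undominated V E ends t c F} \<subseteq> Pow E" by (auto simp: undominated_def dest: cut_subset)
    qed (use hyp in \<open>simp add: hypergraph_def\<close>)
    ultimately have "card ?M \<le> card {F. undominated V E ends t c F}" by (rule card_mono[rotated])
    also have "\<dots> \<le> loss r t (card V) * (card V ^ (t - 1) * 2 ^ (r * t))"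
      by (rule card_undominated_cuts[OF hyp rank pos V])
    also have "\<dots> \<le> (r * card V ^ (2 * t)) * (card V ^ (t - 1) * 2 ^ (r * t))"
      using loss_le[OF r n] by (rule mult_le_mono1)
    also have "\<dots> = r * 2 ^ (r * t) * card V ^ (2 * t + (t - 1))"
      by (simp add: power_add ac_simps)
    also have "2 * t + (t - 1) = 3 * t - 1" using pos by simp
    finally show ?thesis .
  qed
qed simp

theorem theorem1:
  "\<exists>C::real. 0 < C \<and>
     (\<forall>(V::'v set) (E::'e set) (ends::'e \<Rightarrow> 'v set) (n::nat) (r::nat) (t::nat) (c::nat \<Rightarrow> 'e \<Rightarrow> nat).
        hypergraph V E ends \<and> card V = n \<and> E \<noteq> {} \<and> rank E ends = r \<and> 1 \<le> r \<and> 1 \<le> t \<and>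
        no_free_cut V E ends (c t) \<longrightarrow>
        real (card {F. is_multiobjective_min_cut V E ends t c F})
          \<le> C * (real r * 2 ^ (r * t) * real n ^ (3 * t - 1)))"
proof (intro exI[of _ 1] conjI allI impI)
  fix V :: "'v set" and E :: "'e set" and ends :: "'e \<Rightarrow> 'v set" and n r t :: nat
    and c :: "nat \<Rightarrow> 'e \<Rightarrow> nat"
  assume A: "hypergraph V E ends \<and> card V = n \<and> E \<noteq> {} \<and> rank E ends = r \<and> 1 \<le> r \<and> 1 \<le> t \<and>
    no_free_cut V E ends (c t)"
  have "card (ends e) \<le> r" if "e \<in> E" for e
    using A that by (auto simp: rank_def hypergraph_def)
  then have "card {F. is_multiobjective_min_cut V E ends t c F}
      \<le> r * 2 ^ (r * t) * n ^ (3 * t - 1)"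
    using card_multiobjective_min_cuts[of V E ends r t c] A by blast
  then have "real (card {F. is_multiobjective_min_cut V E ends t c F})
      \<le> real (r * 2 ^ (r * t) * n ^ (3 * t - 1))"
    by (rule of_nat_mono)
  then show "real (card {F. is_multiobjective_min_cut V E ends t c F})
      \<le> 1 * (real r * 2 ^ (r * t) * real n ^ (3 * t - 1))"
    by simp
qed simp

end
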